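(* For every integer $n\geq 3$, $$\phi\big((C_{2n},-),\lambda\big)=\big(\phi(C_n^{1},\lambda)\big)^2,$$ where $\phi\big((C_{2n},-),\lambda\big)=\det(\lambda I-A)$ for $A$ the signed adjacency matrix of the signed cycle $(C_{2n},-)$, and $\phi(C_n^1,\lambda)=\det(\lambda I-H(C_n^1))$.
   Context: A mixed graph has undirected edges and directed edges (ordered pairs $(x,y)$). For a mixed graph $X$ with vertices $v_1,\dots,v_n$, the Hermitian adjacency matrix $H(X)$ has $(j,k)$ entry $1$ if $v_jv_k$ is an undirected edge, $i$ if $(v_j,v_k)$ is a directed edge, $-i$ if $(v_k,v_j)$ is a directed edge, and $0$ otherwise. $C_n^1$ denotes the mixed cycle of order $n$ with exactly one directed edge and all other edges undirected. A signed graph is a simple graph with each edge given a sign $\pm1$; its signed adjacency matrix has $(j,k)$ entry equal to the sign of the edge $v_jv_k$ if it exists and $0$ otherwise. $(C_{2n},-)$ denotes the cycle of order $2n$ with exactly one negative edge and all other edges positive. *)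

theory Defs
  imports "Jordan_Normal_Form.Char_Poly"
begin

text \<open>Graphs are given by a vertex set and a set of edges, an undirected edge being a two-element
  set of vertices.\<close>

definition simple_graph :: "'a set \<Rightarrow> 'a set set \<Rightarrow> bool" where
  "simple_graph V E \<longleftrightarrow> finite V \<and> (\<forall>e\<in>E. \<exists>x\<in>V. \<exists>y\<in>V. x \<noteq> y \<and> e = {x, y})"

text \<open>For \<open>n \<ge> 3\<close>, the graph \<open>(V, E)\<close> is a cycle of order \<open>n\<close>. For smaller \<open>n\<close> the condition would
  admit degenerate edges, so it is excluded.\<close>

definition cycle_graph :: "nat \<Rightarrow> 'a set \<Rightarrow> 'a set set \<Rightarrow> bool" where
  "cycle_graph n V E \<longleftrightarrow> n \<ge> 3 \<and>
     (\<exists>cs. distinct cs \<and> length cs = n \<and> set cs = V \<and>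
           E = {{cs ! i, cs ! (Suc i mod n)} | i. i < n})"

record 'a mixed_graph =
  mverts :: "'a set"
  uedges :: "'a set set"
  dedges :: "('a \<times> 'a) set"

definition underlying_edges :: "'a mixed_graph \<Rightarrow> 'a set set" where
  "underlying_edges X = uedges X \<union> {{x, y} | x y. (x, y) \<in> dedges X}"

text \<open>Two vertices are joined by at most one edge, which is either undirected or directed in just
  one of the two directions.\<close>

definition mixed_graph :: "'a mixed_graph \<Rightarrow> bool" where
  "mixed_graph X \<longleftrightarrow> simple_graph (mverts X) (underlying_edges X) \<and>
     (\<forall>x y. (x, y) \<in> dedges X \<longrightarrow> (y, x) \<notin> dedges X \<and> {x, y} \<notin> uedges X)"

text \<open>Adjacency matrices are taken with respect to an enumeration of the vertices, given as a
  list without repetitions.\<close>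

definition vertex_enum :: "'a list \<Rightarrow> 'a set \<Rightarrow> bool" where
  "vertex_enum vs V \<longleftrightarrow> distinct vs \<and> set vs = V"

definition hermitian_adjacency :: "'a mixed_graph \<Rightarrow> 'a list \<Rightarrow> complex mat" where
  "hermitian_adjacency X vs = mat (length vs) (length vs) (\<lambda>(j, k).
     if {vs ! j, vs ! k} \<in> uedges X then 1
     else if (vs ! j, vs ! k) \<in> dedges X then \<i>
     else if (vs ! k, vs ! j) \<in> dedges X then - \<i>
     else 0)"

text \<open>\<open>X\<close> is a copy of \<open>C\<^sub>n\<^sup>1\<close>, the mixed cycle of order \<open>n\<close> with exactly one directed edge.\<close>

definition mixed_cycle_one :: "nat \<Rightarrow> 'a mixed_graph \<Rightarrow> bool" where
  "mixed_cycle_one n X \<longleftrightarrow> mixed_graph X \<and>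
     cycle_graph n (mverts X) (underlying_edges X) \<and> card (dedges X) = 1"

text \<open>Only the values of \<open>sgn_of\<close> on edges are relevant.\<close>

record 'a signed_graph =
  sverts :: "'a set"
  sedges :: "'a set set"
  sgn_of :: "'a set \<Rightarrow> int"

definition signed_graph :: "'a signed_graph \<Rightarrow> bool" where
  "signed_graph S \<longleftrightarrow> simple_graph (sverts S) (sedges S) \<and>
     (\<forall>e\<in>sedges S. sgn_of S e = 1 \<or> sgn_of S e = -1)"

text \<open>The entries lie in \<open>{-1, 0, 1}\<close>; the ring in which they are read is left open so that the
  characteristic polynomial can be compared with one over the complex numbers.\<close>

definition signed_adjacency :: "'a signed_graph \<Rightarrow> 'a list \<Rightarrow> 'r :: ring_1 mat" where
  "signed_adjacency S vs = mat (length vs) (length vs) (\<lambda>(j, k).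
     if {vs ! j, vs ! k} \<in> sedges S then of_int (sgn_of S {vs ! j, vs ! k}) else 0)"

text \<open>\<open>S\<close> is a copy of \<open>(C\<^sub>m, -)\<close>, the signed cycle of order \<open>m\<close> with exactly one negative edge.\<close>

definition signed_cycle_one_neg :: "nat \<Rightarrow> 'a signed_graph \<Rightarrow> bool" where
  "signed_cycle_one_neg m S \<longleftrightarrow> signed_graph S \<and>
     cycle_graph m (sverts S) (sedges S) \<and> card {e \<in> sedges S. sgn_of S e = -1} = 1"

end

theory Submission
  imports Defs
begin

text \<open>Number the vertices so that the special edge closes the cycle. With \<open>P\<close> the adjacency matrix
  of the path on \<open>n\<close> vertices and \<open>Q\<close> the antisymmetric matrix supported on the two corners, the
  signed cycle of order \<open>2n\<close> has the matrix with block rows \<open>(P, Q)\<close> and \<open>(-Q, P)\<close>. A shear by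
  \<open>\<i>\<close> makes it block triangular with diagonal blocks \<open>P + \<i>Q\<close> and \<open>P - \<i>Q\<close>. These are the Hermitian
  matrices of the two orientations of the directed edge; they are transposes of each other.\<close>

section \<open>Characteristic polynomials\<close>

text \<open>Renumbering the vertices conjugates the matrix by a permutation matrix. This later
  allows an arbitrary enumeration to be replaced by one that runs along the cycle.\<close>

lemma char_poly_enum_cong:
  fixes f :: "'a \<Rightarrow> 'a \<Rightarrow> 'r :: comm_ring_1"
  assumes "distinct vs" "distinct ws" "set vs = set ws"
  shows "char_poly (mat (length vs) (length vs) (\<lambda>(j, k). f (vs ! j) (vs ! k)))
       = char_poly (mat (length ws) (length ws) (\<lambda>(j, k). f (ws ! j) (ws ! k)))"
    (is "char_poly ?A = char_poly ?B")
proof -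
  let ?n = "length vs"
  have len: "length ws = ?n"
    using assms by (metis distinct_card)
  \<comment> \<open>The permutation matrix between two enumerations: a row and a column meet in 1
    when they name the same vertex.\<close>
  define T where "T us us' = mat ?n ?n (\<lambda>(j, k). if us ! j = us' ! k then 1 else 0 :: 'r)"
    for us us' :: "'a list"
  \<comment> \<open>Sums over positions become sums over vertices, where the products with
    \<open>T\<close> collapse to a single term.\<close>
  have sum_nth: "(\<Sum>k = 0..<?n. h (us ! k)) = sum h (set vs)"
    if "distinct us" "set us = set vs" for us and h :: "'a \<Rightarrow> 'r"
  proof -
    have "length us = ?n"
      using that assms(1) by (metis distinct_card)
    then have "bij_betw ((!) us) {0..<?n} (set vs)"
      using that by (intro bij_betw_nth) auto
    then show ?thesis
      by (rule sum.reindex_bij_betw)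
  qed
  have T: "T us us' \<in> carrier_mat ?n ?n" for us us'
    by (simp add: T_def)
  have sv: "set ws = set vs" and fin: "finite (set vs)"
    using assms by auto
  have inv: "T us us' * T us' us = 1\<^sub>m ?n"
    if us: "distinct us" "set us = set vs" and us': "distinct us'" "set us' = set vs" for us us'
  proof (rule eq_matI, goal_cases)
    case (1 i j)
    then have ij: "i < ?n" "j < ?n"
      by auto
    have l: "length us = ?n"
      using us assms(1) by (metis distinct_card)
    have "(T us us' * T us' us) $$ (i, j)
        = (\<Sum>k = 0..<?n. (\<lambda>a. if us ! i = a then if a = us ! j then 1 else 0 else 0) (us' ! k))"
      using ij by (auto simp: T_def scalar_prod_def intro!: sum.cong)
    also have "\<dots> = (\<Sum>a\<in>set vs. if us ! i = a then if a = us ! j then 1 else 0 else 0)"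
      by (rule sum_nth[OF us'])
    also have "\<dots> = (if us ! i = us ! j then 1 else 0)"
      using ij l us(2) fin nth_mem[of i us] by simp
    also have "\<dots> = 1\<^sub>m ?n $$ (i, j)"
      using ij l us(1) by (simp add: nth_eq_iff_index_eq)
    finally show ?case .
  qed (auto simp: T_def)
  have BT: "?B * T ws vs = mat ?n ?n (\<lambda>(j, k). f (ws ! j) (vs ! k))"
  proof (rule eq_matI, goal_cases)
    case (1 i j)
    then have ij: "i < ?n" "j < ?n"
      by auto
    have "(?B * T ws vs) $$ (i, j)
        = (\<Sum>k = 0..<?n. (\<lambda>a. if a = vs ! j then f (ws ! i) a else 0) (ws ! k))"
      using ij by (auto simp: T_def scalar_prod_def len intro!: sum.cong)
    also have "\<dots> = (\<Sum>a\<in>set vs. if a = vs ! j then f (ws ! i) a else 0)"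
      by (rule sum_nth[OF assms(2) sv])
    also have "\<dots> = f (ws ! i) (vs ! j)"
      using ij fin by simp
    finally show ?case
      using ij by simp
  qed (auto simp: T_def len)
  have "T vs ws * (?B * T ws vs) = ?A"
    unfolding BT
  proof (rule eq_matI, goal_cases)
    case (1 i j)
    then have ij: "i < ?n" "j < ?n"
      by auto
    have "(T vs ws * mat ?n ?n (\<lambda>(j, k). f (ws ! j) (vs ! k))) $$ (i, j)
        = (\<Sum>k = 0..<?n. (\<lambda>a. if vs ! i = a then f a (vs ! j) else 0) (ws ! k))"
      using ij by (auto simp: T_def scalar_prod_def intro!: sum.cong)
    also have "\<dots> = (\<Sum>a\<in>set vs. if vs ! i = a then f a (vs ! j) else 0)"
      by (rule sum_nth[OF assms(2) sv])
    also have "\<dots> = f (vs ! i) (vs ! j)"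
      using ij fin by simp
    finally show ?case
      using ij by simp
  qed (auto simp: T_def)
  then have "?A = T vs ws * ?B * T ws vs"
    by (simp add: assoc_mult_mat[OF T _ T] len)
  moreover have "{?A, ?B, T vs ws, T ws vs} \<subseteq> carrier_mat ?n ?n"
    using T len by simp
  ultimately have "similar_mat ?A ?B"
    using inv[OF assms(1) refl assms(2) sv] inv[OF assms(2) sv assms(1) refl]
    by (intro similar_matI)
  then show ?thesis
    by (rule char_poly_similar)
qed

lemma char_poly_four_block_upper_triangular:
  fixes A :: "'r :: idom mat"
  assumes A: "A \<in> carrier_mat n n" and B: "B \<in> carrier_mat n m" and D: "D \<in> carrier_mat m m"
  shows "char_poly (four_block_mat A B (0\<^sub>m m n) D) = char_poly A * char_poly D"
proof -
  \<comment> \<open>The indeterminate occurs on the main diagonal only, so the upper right block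
    consists of constant polynomials and the lower left one stays zero.\<close>
  have "char_poly_matrix (four_block_mat A B (0\<^sub>m m n) D)
      = four_block_mat (char_poly_matrix A) (map_mat (\<lambda>a. [:- a:]) B) (0\<^sub>m m n) (char_poly_matrix D)"
    using assms by (intro eq_matI) (auto simp: char_poly_matrix_def)
  moreover have "det \<dots> = det (char_poly_matrix A) * det (char_poly_matrix D)"
    using assms by (intro det_four_block_mat_lower_left_zero) auto
  ultimately show ?thesis
    by (simp add: char_poly_def)
qed

text \<open>The vectors \<open>(v, \<i> v)\<close> form an invariant subspace on which the block
  matrix acts as \<open>P + \<i>Q\<close>; on the quotient it acts as
  \<open>P - \<i>Q\<close>.\<close>

lemma char_poly_four_block_skew:
  fixes P Q :: "complex mat"
  assumes P: "P \<in> carrier_mat n n" and Q: "Q \<in> carrier_mat n n"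
  shows "char_poly (four_block_mat P Q (- Q) P)
       = char_poly (P + \<i> \<cdot>\<^sub>m Q) * char_poly (P - \<i> \<cdot>\<^sub>m Q)"
proof -
  let ?A = "four_block_mat P Q (- Q) P"
  let ?B = "four_block_mat (P + \<i> \<cdot>\<^sub>m Q) Q (0\<^sub>m n n) (P - \<i> \<cdot>\<^sub>m Q)"
  \<comment> \<open>For \<open>c = \<i>\<close> the first block column spans this subspace; the
    opposite shear is the inverse.\<close>
  let ?T = "\<lambda>c. four_block_mat (1\<^sub>m n) (0\<^sub>m n n) (c \<cdot>\<^sub>m 1\<^sub>m n) (1\<^sub>m n) :: complex mat"
  have T: "?T c \<in> carrier_mat (n + n) (n + n)" for c
    by (rule four_block_carrier_mat) auto
  have inv: "?T c * ?T d = 1\<^sub>m (n + n)" if "c + d = 0" for c d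
  proof -
    have "c \<cdot>\<^sub>m 1\<^sub>m n + d \<cdot>\<^sub>m 1\<^sub>m n = 0\<^sub>m n n"
      using that by (intro eq_matI) auto
    then show ?thesis
      by (subst mult_four_block_mat[of _ n n _ n _ n]) (auto simp: mult_smult_distrib)
  qed
  have "?T \<i> * ?B = ?A * ?T \<i>"
  proof -
    have "?T \<i> * ?B = four_block_mat (P + \<i> \<cdot>\<^sub>m Q) Q (\<i> \<cdot>\<^sub>m (P + \<i> \<cdot>\<^sub>m Q)) (\<i> \<cdot>\<^sub>m Q + (P - \<i> \<cdot>\<^sub>m Q))"
      using P Q by (subst mult_four_block_mat[of _ n n _ n _ n])
        (auto intro!: arg_cong2[of _ _ _ _ "\<lambda>C D. four_block_mat _ _ C D"] simp: mult_smult_assoc_mat[of _ n n])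
    also have "\<dots> = four_block_mat (P + \<i> \<cdot>\<^sub>m Q) Q (- Q + \<i> \<cdot>\<^sub>m P) P"
      using P Q by (intro arg_cong2[of _ _ _ _ "\<lambda>C D. four_block_mat _ _ C D"] eq_matI)
        (auto simp: algebra_simps)
    also have "\<dots> = ?A * ?T \<i>"
      using P Q by (subst mult_four_block_mat[of _ n n _ n _ n])
        (auto simp: mult_smult_distrib[of _ n n])
    finally show ?thesis .
  qed
  moreover have "?A \<in> carrier_mat (n + n) (n + n)"
    using P by (intro four_block_carrier_mat)
  ultimately have "?T \<i> * ?B * ?T (- \<i>) = ?A * (?T \<i> * ?T (- \<i>))"
    by (metis T assoc_mult_mat)
  also have "\<dots> = ?A"
    using P by (subst inv) auto
  finally have "similar_mat ?A ?B"
    using P Q T inv[of \<i> "- \<i>"] inv[of "- \<i>" \<i>]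
    by (intro similar_matI[of _ _ "?T \<i>" "?T (- \<i>)" "n + n"]) auto
  then have "char_poly ?A = char_poly ?B"
    by (rule char_poly_similar)
  also have "\<dots> = char_poly (P + \<i> \<cdot>\<^sub>m Q) * char_poly (P - \<i> \<cdot>\<^sub>m Q)"
    using P Q by (intro char_poly_four_block_upper_triangular) auto
  finally show ?thesis .
qed

section \<open>Weighted cycles\<close>

text \<open>For \<open>m \<ge> 3\<close>, a cycle numbered consecutively whose closing edge has
  weight \<open>a\<close> from last to first vertex and \<open>b\<close> in the other direction.
  Both corners zero give the path.\<close>

definition cycle_mat :: "nat \<Rightarrow> complex \<Rightarrow> complex \<Rightarrow> complex mat" where
  "cycle_mat m a b = mat m m (\<lambda>(j, k).
     if k = Suc j \<or> j = Suc k then 1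
     else if j = m - 1 \<and> k = 0 then a
     else if j = 0 \<and> k = m - 1 then b
     else 0)"

lemma cycle_mat_carrier: "cycle_mat m a b \<in> carrier_mat m m"
  by (simp add: cycle_mat_def)

text \<open>Transposition swaps the corners, so reversing the directed edge does not change the
  polynomial.\<close>

lemma char_poly_cycle_mat_commute:
  assumes "m \<ge> 2"
  shows "char_poly (cycle_mat m a b) = char_poly (cycle_mat m b a)"
proof -
  have "cycle_mat m a b = transpose_mat (cycle_mat m b a)"
    using assms by (intro eq_matI) (auto simp: cycle_mat_def)
  then show ?thesis
    by (metis char_poly_transpose_mat cycle_mat_carrier)
qed

text \<open>Cut the cycle into two runs of \<open>n\<close> consecutive vertices. Each run is a
  path, and the runs are joined by one positive edge and the negative closing edge; these opposite
  signs make \<open>Q\<close> antisymmetric.\<close>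

lemma char_poly_cycle_mat_double:
  assumes "n \<ge> 3"
  shows "char_poly (cycle_mat (2 * n) (- 1) (- 1)) = (char_poly (cycle_mat n \<i> (- \<i>)))\<^sup>2"
proof -
  define P where "P = cycle_mat n 0 0"
  define Q where "Q = mat n n (\<lambda>(j, k). if j = n - 1 \<and> k = 0 then 1
     else if j = 0 \<and> k = n - 1 then - 1 else 0 :: complex)"
  have "cycle_mat (2 * n) (- 1) (- 1) = four_block_mat P Q (- Q) P"
  proof (rule eq_matI, goal_cases)
    case (1 j k)
    then have "j < 2 * n" "k < 2 * n"
      by (auto simp: P_def cycle_mat_def)
    then consider "j < n" "k < n"
      | k' where "j < n" "k = n + k'" "k' < n"
      | j' where "j = n + j'" "j' < n" "k < n"
      | j' k' where "j = n + j'" "j' < n" "k = n + k'" "k' < n"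
      by (cases "j < n"; cases "k < n") (auto dest!: le_Suc_ex simp: not_less)
    then show ?case
    proof cases
      case 1
      then have "j \<noteq> 2 * n - 1" "k \<noteq> 2 * n - 1"
        using assms by auto
      with 1 show ?thesis
        using assms by (simp add: cycle_mat_def P_def Q_def)
    next
      case 2
      \<comment> \<open>Edges between the halves: the step from \<open>n - 1\<close> to
        \<open>n\<close> gives the entry 1 of \<open>Q\<close>, the closing edge gives its entry
        -1.\<close>
      then have "k = Suc j \<longleftrightarrow> j = n - 1 \<and> k' = 0" "k = 2 * n - 1 \<longleftrightarrow> k' = n - 1"
        "j \<noteq> Suc k" "j \<noteq> 2 * n - 1"
        using assms by linarith+
      with 2 show ?thesis
        using assms by (simp add: cycle_mat_def P_def Q_def)
    next
      case 3
      then have "j = Suc k \<longleftrightarrow> k = n - 1 \<and> j' = 0" "j = 2 * n - 1 \<longleftrightarrow> j' = n - 1"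
        "k \<noteq> Suc j" "k \<noteq> 2 * n - 1"
        using assms by linarith+
      with 3 show ?thesis
        using assms by (simp add: cycle_mat_def P_def Q_def)
    next
      case 4
      then show ?thesis
        using assms by (simp add: cycle_mat_def P_def Q_def)
    qed
  qed (auto simp: P_def cycle_mat_def)
  moreover have "P + \<i> \<cdot>\<^sub>m Q = cycle_mat n \<i> (- \<i>)" "P - \<i> \<cdot>\<^sub>m Q = cycle_mat n (- \<i>) \<i>"
  proof -
    \<comment> \<open>With three explicit successors the corners are visibly distinct from the
      neighbour positions, so \<open>P\<close> and \<open>Q\<close> have disjoint supports.\<close>
    obtain l where "n = Suc (Suc (Suc l))"
      using assms that[of "n - 3"] by linarith
    then show "P + \<i> \<cdot>\<^sub>m Q = cycle_mat n \<i> (- \<i>)" "P - \<i> \<cdot>\<^sub>m Q = cycle_mat n (- \<i>) \<i>"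
      by (auto intro!: eq_matI simp: cycle_mat_def P_def Q_def)
  qed
  moreover have "P \<in> carrier_mat n n" "Q \<in> carrier_mat n n"
    by (auto simp: P_def Q_def cycle_mat_carrier)
  ultimately show ?thesis
    using assms char_poly_cycle_mat_commute[of n \<i> "- \<i>"]
    by (simp add: char_poly_four_block_skew power2_eq_square)
qed

section \<open>Numbering a cycle\<close>

text \<open>The edge set from \<open>cycle_graph\<close> as a function of the list, so that
  rotations can be applied to it.\<close>

definition cycle_edges :: "'a list \<Rightarrow> 'a set set" where
  "cycle_edges cs = {{cs ! i, cs ! (Suc i mod length cs)} | i. i < length cs}"

lemma cycle_edges_rotate_subset: "cycle_edges (rotate m cs) \<subseteq> cycle_edges cs"
proof
  fix e
  assume "e \<in> cycle_edges (rotate m cs)"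
  then obtain j where j: "j < length cs"
    and e: "e = {rotate m cs ! j, rotate m cs ! (Suc j mod length cs)}"
    by (auto simp: cycle_edges_def)
  have "Suc j mod length cs < length cs"
    using j by (intro mod_less_divisor) linarith
  then have "e = {cs ! ((m + j) mod length cs), cs ! (Suc ((m + j) mod length cs) mod length cs)}"
    using j by (simp add: e nth_rotate mod_simps)
  moreover have "(m + j) mod length cs < length cs"
    using j by (intro mod_less_divisor) linarith
  ultimately show "e \<in> cycle_edges cs"
    by (auto simp: cycle_edges_def)
qed

lemma cycle_edges_rotate:
  assumes "m \<le> length cs"
  shows "cycle_edges (rotate m cs) = cycle_edges cs"
proof
  \<comment> \<open>The converse inclusion comes from completing the full turn.\<close>
  have "rotate (length cs - m) (rotate m cs) = cs"
    using assms by (simp add: rotate_rotate)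
  then show "cycle_edges cs \<subseteq> cycle_edges (rotate m cs)"
    by (metis cycle_edges_rotate_subset)
qed (rule cycle_edges_rotate_subset)

text \<open>A rotation of the vertex list brings any chosen edge to the closing position, which
  corresponds to the corners of \<open>cycle_mat\<close>.\<close>

lemma cycle_graph_closing_edge:
  assumes "cycle_graph m V E" "e \<in> E"
  obtains cs where "distinct cs" "length cs = m" "set cs = V" "E = cycle_edges cs"
    "e = {cs ! (m - 1), cs ! 0}"
proof -
  from assms obtain cs where cs: "distinct cs" "length cs = m" "set cs = V" "E = cycle_edges cs"
    and m: "m \<ge> 3"
    by (auto simp: cycle_graph_def cycle_edges_def)
  from assms(2) obtain i where i: "i < m" "e = {cs ! i, cs ! (Suc i mod m)}"
    unfolding cs(4) by (auto simp: cycle_edges_def cs(2))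
  \<comment> \<open>This rotation sends position \<open>i\<close> to \<open>m - 1\<close> and its
    cyclic successor to 0.\<close>
  let ?ds = "rotate (Suc i) cs"
  have "Suc i + (m - 1) = i + m"
    using m by simp
  then have "(Suc i + (m - 1)) mod m = i"
    using i(1) by simp
  then have "e = {?ds ! (m - 1), ?ds ! 0}"
    using i m by (simp add: nth_rotate cs(2) del: rotate_Suc)
  then show ?thesis
    using cs i(1) by (intro that[of ?ds]) (auto simp: cycle_edges_rotate simp del: rotate_Suc)
qed

text \<open>Distinctness turns equality of vertices into equality of indices, and the wrap-around of
  \<open>Suc\<close> modulo \<open>m\<close> yields the two corner cases.\<close>

lemma cycle_edges_nth_iff:
  assumes "distinct cs" "length cs = m" "m \<ge> 3" "j < m" "k < m"
  shows "{cs ! j, cs ! k} \<in> cycle_edges cs \<longleftrightarrow>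
    k = Suc j \<or> j = Suc k \<or> (j = m - 1 \<and> k = 0) \<or> (j = 0 \<and> k = m - 1)"
proof -
  have lt: "Suc i mod m < m" for i
    using assms(3) by (intro mod_less_divisor) linarith
  have "{cs ! j, cs ! k} \<in> cycle_edges cs \<longleftrightarrow>
      (\<exists>i<m. j = i \<and> k = Suc i mod m \<or> j = Suc i mod m \<and> k = i)"
    using assms lt by (auto simp: cycle_edges_def doubleton_eq_iff nth_eq_iff_index_eq)
  also have "\<dots> \<longleftrightarrow> k = Suc j mod m \<or> j = Suc k mod m"
    using assms by auto
  also have "\<dots> \<longleftrightarrow> k = Suc j \<or> j = Suc k \<or> (j = m - 1 \<and> k = 0) \<or> (j = 0 \<and> k = m - 1)"
    using assms by (auto simp: mod_Suc)
  finally show ?thesis .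
qed

lemma closing_edge_nth_iff:
  assumes "distinct cs" "length cs = m" "m \<ge> 3" "j < m" "k < m"
  shows "{cs ! j, cs ! k} = {cs ! (m - 1), cs ! 0} \<longleftrightarrow>
    (j = m - 1 \<and> k = 0) \<or> (j = 0 \<and> k = m - 1)"
  using assms by (auto simp: doubleton_eq_iff nth_eq_iff_index_eq)

section \<open>Reduction of both graphs to weighted cycles\<close>

lemma char_poly_signed_cycle:
  assumes "signed_cycle_one_neg m S" "vertex_enum ws (sverts S)"
  shows "char_poly (signed_adjacency S ws :: complex mat) = char_poly (cycle_mat m (- 1) (- 1))"
proof -
  from assms(1) have S: "signed_graph S" "cycle_graph m (sverts S) (sedges S)"
    and "card {e \<in> sedges S. sgn_of S e = - 1} = 1"
    by (auto simp: signed_cycle_one_neg_def)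
  then obtain e where e: "{e \<in> sedges S. sgn_of S e = - 1} = {e}"
    by (auto simp: card_1_singleton_iff)
  have sgn: "sgn_of S d = (if d = e then - 1 else 1)" if "d \<in> sedges S" for d
    using that S(1) e by (auto simp: signed_graph_def)
  have m: "m \<ge> 3" and "e \<in> sedges S"
    using S(2) e by (auto simp: cycle_graph_def)
  with S(2) obtain cs where cs: "distinct cs" "length cs = m" "set cs = sverts S"
    "sedges S = cycle_edges cs" "e = {cs ! (m - 1), cs ! 0}"
    by (elim cycle_graph_closing_edge)
  have "char_poly (signed_adjacency S ws :: complex mat) = char_poly (signed_adjacency S cs)"
    unfolding signed_adjacency_def
    using assms(2) cs by (intro char_poly_enum_cong) (auto simp: vertex_enum_def)
  also have "signed_adjacency S cs = cycle_mat m (- 1) (- 1)"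
  proof (rule eq_matI, goal_cases)
    case (1 j k)
    then have jk: "j < m" "k < m"
      by (auto simp: cycle_mat_def)
    have "signed_adjacency S cs $$ (j, k)
        = (if {cs ! j, cs ! k} \<in> sedges S then if {cs ! j, cs ! k} = e then - 1 else 1
           else (0 :: complex))"
      using jk cs(2) sgn by (simp add: signed_adjacency_def)
    also have "\<dots> = cycle_mat m (- 1) (- 1) $$ (j, k)"
      unfolding cs(4,5) cycle_edges_nth_iff[OF cs(1,2) m jk] closing_edge_nth_iff[OF cs(1,2) m jk]
      using jk m by (auto simp: cycle_mat_def)
    finally show ?case .
  qed (auto simp: signed_adjacency_def cycle_mat_def cs(2))
  finally show ?thesis .
qed

text \<open>The numbering puts the directed edge at the corners without fixing its orientation. Both
  orientations occur as cases and agree by \<open>char_poly_cycle_mat_commute\<close>.\<close>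

lemma char_poly_mixed_cycle:
  assumes "mixed_cycle_one n X" "vertex_enum vs (mverts X)"
  shows "char_poly (hermitian_adjacency X vs) = char_poly (cycle_mat n \<i> (- \<i>))"
proof -
  from assms(1) have X: "mixed_graph X" "cycle_graph n (mverts X) (underlying_edges X)"
    and "card (dedges X) = 1"
    by (auto simp: mixed_cycle_one_def)
  then obtain x y where xy: "dedges X = {(x, y)}"
    by (auto simp: card_1_singleton_iff)
  have n: "n \<ge> 3"
    using X(2) by (auto simp: cycle_graph_def)
  have un: "underlying_edges X = insert {x, y} (uedges X)"
    by (auto simp: underlying_edges_def xy)
  with X(2) obtain cs where cs: "distinct cs" "length cs = n" "set cs = mverts X"
    "underlying_edges X = cycle_edges cs" "{x, y} = {cs ! (n - 1), cs ! 0}"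
    by (metis cycle_graph_closing_edge insertI1)
  \<comment> \<open>As \<open>mixed_graph\<close> keeps \<open>{x, y}\<close> out of
    \<open>uedges X\<close>, the undirected edges are exactly the others.\<close>
  have ued: "d \<in> uedges X \<longleftrightarrow> d \<in> cycle_edges cs \<and> d \<noteq> {cs ! (n - 1), cs ! 0}" for d
    using X(1) un unfolding cs(4,5)[symmetric] by (auto simp: mixed_graph_def xy)
  have "char_poly (hermitian_adjacency X vs) = char_poly (hermitian_adjacency X cs)"
    unfolding hermitian_adjacency_def
    using assms(2) cs by (intro char_poly_enum_cong) (auto simp: vertex_enum_def)
  also have "\<dots> = char_poly (cycle_mat n \<i> (- \<i>))"
  proof -
    have entry: "hermitian_adjacency X cs $$ (j, k)
        = (if k = Suc j \<or> j = Suc k then 1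
           else if (cs ! j, cs ! k) = (x, y) then \<i>
           else if (cs ! k, cs ! j) = (x, y) then - \<i> else 0)"
      if jk: "j < n" "k < n" for j k
    proof -
      \<comment> \<open>Since \<open>n \<ge> 3\<close>, the ends of the closing edge do not have
        consecutive indices.\<close>
      have "{cs ! j, cs ! k} \<in> uedges X \<longleftrightarrow> k = Suc j \<or> j = Suc k"
        unfolding ued cycle_edges_nth_iff[OF cs(1,2) n jk] closing_edge_nth_iff[OF cs(1,2) n jk]
        using n by (cases "j = 0"; cases "k = 0") linarith+
      then show ?thesis
        using jk by (simp add: hermitian_adjacency_def cs(2) xy)
    qed
    have idx: "cs ! j = cs ! k \<longleftrightarrow> j = k" if "j < n" "k < n" for j k
      using that cs(1,2) by (simp add: nth_eq_iff_index_eq)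
    have ends: "n - 1 < n" "0 < n"
      using n by auto
    from cs(5) consider "x = cs ! (n - 1)" "y = cs ! 0" | "x = cs ! 0" "y = cs ! (n - 1)"
      by (auto simp: doubleton_eq_iff)
    then show ?thesis
    proof cases
      case 1
      then have "hermitian_adjacency X cs = cycle_mat n \<i> (- \<i>)"
        using n by (intro eq_matI)
          (simp_all add: cycle_mat_def entry idx ends, simp_all add: hermitian_adjacency_def cs(2))
      then show ?thesis
        by simp
    next
      \<comment> \<open>The edge runs from first to last vertex, so \<open>\<i>\<close> sits in the
        upper right corner.\<close>
      case 2
      then have "hermitian_adjacency X cs = cycle_mat n (- \<i>) \<i>"
        using n by (intro eq_matI)
          (simp_all add: cycle_mat_def entry idx ends, simp_all add: hermitian_adjacency_def cs(2))
      then show ?thesis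
        using n by (simp add: char_poly_cycle_mat_commute[of n \<i>])
    qed
  qed
  finally show ?thesis .
qed

theorem theorem2p3:
  fixes n :: nat
    and S :: "'a signed_graph" and ws :: "'a list"
    and X :: "'b mixed_graph" and vs :: "'b list"
  assumes "n \<ge> 3"
    and "signed_cycle_one_neg (2 * n) S" and "vertex_enum ws (sverts S)"
    and "mixed_cycle_one n X" and "vertex_enum vs (mverts X)"
  shows "char_poly (signed_adjacency S ws :: complex mat)
       = (char_poly (hermitian_adjacency X vs))\<^sup>2"
  unfolding char_poly_signed_cycle[OF assms(2,3)] char_poly_mixed_cycle[OF assms(4,5)]
  by (rule char_poly_cycle_mat_double[OF assms(1)])

end
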